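(* Let $m\ge1$ and let $k, n_1,\ldots,n_m$ be integers with $n_i \geq k >0$ for all $i \in [m]$. Let $M$ be the complement of a $(k ; n_1, \ldots, n_m)$ circulant block diagonal matrix. Suppose that there exists an integer $d >1$ such that $d = \gcd(n_i,k)$ for all $i \in [m]$ and such that $n_i > d$ for some $i \in [m]$. Then $\mathrm{rank}_{\mathrm{bin}}(M) \geq \mathrm{rank}_{\mathbb{R}}(M) + 1$.
   Context: For integers $n \ge k \ge 0$, $D_{n,k}$ denotes the $n\times n$ circulant $0,1$ matrix whose first row consists of $n-k$ ones followed by $k$ zeros, each subsequent row being the cyclic shift of the previous row by one position to the right. For integers $n_i\ge k\ge 0$, a $(k;n_1,\ldots,n_m)$ circulant block diagonal matrix is a block matrix with $m$ diagonal blocks whose $i$th diagonal block is $D_{n_i,n_i-k}$ (first row: $k$ ones followed by $n_i-k$ zeros) and all of whose other entries are zero. The complement of a $0,1$ matrix is obtained by swapping zeros and ones. The binary rank $\mathrm{rank}_{\mathrm{bin}}(A)$ is the smallest number of combinatorial rectangles (all-one submatrices indexed by a set of rows times a set of columns) that partition the ones of $A$. $\mathrm{rank}_{\mathbb{R}}$ is the rank over the reals. *)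

theory Defs
  imports "Jordan_Normal_Form.DL_Rank" "HOL-Library.Disjoint_Sets"
begin

text \<open>Rows and columns are numbered from 0. Shifting right by one position per row means that
  entry (i, j) equals entry (j - i) mod n of the first row.\<close>

definition circulant_D :: "nat \<Rightarrow> nat \<Rightarrow> real mat" where
  "circulant_D n k =
     mat n n (\<lambda>(i, j). if (int j - int i) mod int n < int n - int k then 1 else 0)"

definition circulant_block_diag :: "nat \<Rightarrow> nat list \<Rightarrow> real mat" where
  "circulant_block_diag k ns = diag_block_mat (map (\<lambda>n. circulant_D n (n - k)) ns)"

definition complement_mat :: "real mat \<Rightarrow> real mat" where
  "complement_mat A = map_mat (\<lambda>x. 1 - x) A"

definition ones_of :: "real mat \<Rightarrow> (nat \<times> nat) set" where
  "ones_of A = {(i, j). i < dim_row A \<and> j < dim_col A \<and> A $$ (i, j) = 1}"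

definition rectangle_partition :: "real mat \<Rightarrow> (nat \<times> nat) set set \<Rightarrow> bool" where
  "rectangle_partition A P \<longleftrightarrow>
     finite P \<and> partition_on (ones_of A) P \<and> (\<forall>R\<in>P. \<exists>I J. R = I \<times> J)"

definition binary_rank :: "real mat \<Rightarrow> nat" where
  "binary_rank A = (LEAST r. \<exists>P. rectangle_partition A P \<and> card P = r)"

text \<open>The set over which the minimum is taken is never empty.\<close>

lemma ex_rectangle_partition: "\<exists>P. rectangle_partition A P"
proof -
  have "finite ({..<dim_row A} \<times> {..<dim_col A})" by simp
  moreover have "ones_of A \<subseteq> {..<dim_row A} \<times> {..<dim_col A}"
    by (auto simp: ones_of_def)
  ultimately have "finite (ones_of A)" by (rule rev_finite_subset)
  moreover have "partition_on (ones_of A) ((\<lambda>x. {x}) ` ones_of A)"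
    by (auto simp: partition_on_def disjoint_def)
  moreover have "\<exists>I J. {x} = I \<times> J" for x :: "nat \<times> nat"
    by (rule exI[of _ "{fst x}"], rule exI[of _ "{snd x}"]) auto
  ultimately have "rectangle_partition A ((\<lambda>x. {x}) ` ones_of A)"
    by (auto simp: rectangle_partition_def)
  then show ?thesis ..
qed

lemma binary_rank_attained: "\<exists>P. rectangle_partition A P \<and> card P = binary_rank A"
  unfolding binary_rank_def by (rule LeastI_ex) (use ex_rectangle_partition in blast)

end

theory Submission
  imports Defs
begin

text \<open>Write $n_i = d n'_i$, $k = d k'$, $N' = \sum_i n'_i$, and suppose that $M = XY$ comes from a
  partition into at most $\mathrm{rank}(M)$ rectangles. Then the columns $x_t$ of $X$ and the rows
  $y_t$ of $Y$ are linearly independent, so $x_t$ and $y_t$ are annihilated by the kernels of $M^T$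
  and $M$. These kernels contain the difference of any two residue classes mod $d$ of a block, hence
  within each block the $t$-th rectangle $I \times J$ has equally many rows, and equally many
  columns, in every residue class mod $d$; let $a$ and $b$ be these numbers, summed over the blocks.
  Such a balanced vector $x_t$ can be written explicitly as $M g_t$, independence forces
  $y_t \cdot g_t = 1$, and the explicit form of $g_t$ turns this into the divisibility of $ab$ by
  $N' - k'$. Since the areas $d^2 ab$ add up to the number $d^2 N' (N' - k')$ of ones of $M$, there
  are at most $N'$ rectangles. But the rank of $M$ exceeds $N'$, because $d > 1$.\<close>

section \<open>Homogeneous linear systems, rank and factorizations\<close>

text \<open>Gaussian elimination: an unknown \<open>b\<close> occurring in equation \<open>t\<close>
  is eliminated from the other equations, so both sides of \<open>card T < card C\<close> drop by
  one.\<close>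

lemma underdetermined_system_solution:
  fixes w :: "'c \<Rightarrow> 't \<Rightarrow> 'a::field"
  assumes "finite T" "finite C" "card T < card C"
  shows "\<exists>\<alpha>. (\<exists>c\<in>C. \<alpha> c \<noteq> 0) \<and> (\<forall>t\<in>T. (\<Sum>c\<in>C. \<alpha> c * w c t) = 0)"
  using assms
proof (induction T arbitrary: C w rule: finite_induct)
  case empty
  then obtain c where "c \<in> C" by fastforce
  then show ?case by (intro exI[of _ "\<lambda>_. 1"]) auto
next
  case (insert t T)
  show ?case
  proof (cases "\<forall>c\<in>C. w c t = 0")
    case True
    have "card T < card C" using insert by simp
    with insert.IH[of C w] insert.prems obtain \<alpha> where
      "\<exists>c\<in>C. \<alpha> c \<noteq> 0" "\<forall>s\<in>T. (\<Sum>c\<in>C. \<alpha> c * w c s) = 0" by blast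
    then show ?thesis using True by (intro exI[of _ \<alpha>]) auto
  next
    case False
    then obtain b where b: "b \<in> C" "w b t \<noteq> 0" by blast
    define v where "v c s = w c s - w c t / w b t * w b s" for c s
    have "card T < card (C - {b})" using insert b by simp
    with insert.IH[of "C - {b}" v] insert.prems obtain \<alpha> where
      \<alpha>: "\<exists>c\<in>C - {b}. \<alpha> c \<noteq> 0" "\<forall>s\<in>T. (\<Sum>c\<in>C - {b}. \<alpha> c * v c s) = 0" by blast
    \<comment> \<open>Back-substitution: equation \<open>t\<close> forces the value
      \<open>- S\<close> for the unknown \<open>b\<close>.\<close>
    define S where "S = (\<Sum>c\<in>C - {b}. \<alpha> c * w c t) / w b t"
    define \<beta> where "\<beta> = \<alpha>(b := - S)"
    have split: "(\<Sum>c\<in>C. \<beta> c * w c s) = (\<Sum>c\<in>C - {b}. \<alpha> c * w c s) - S * w b s" for s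
      using insert.prems b by (subst sum.remove[of _ b]) (auto simp: \<beta>_def intro!: sum.cong)
    have "(\<Sum>c\<in>C - {b}. \<alpha> c * v c s) = (\<Sum>c\<in>C - {b}. \<alpha> c * w c s) - S * w b s" for s
      unfolding v_def S_def
      by (simp add: right_diff_distrib sum_subtractf sum_divide_distrib sum_distrib_left
          sum_distrib_right ac_simps)
    then have "(\<Sum>c\<in>C. \<beta> c * w c s) = 0" if "s \<in> T" for s using split \<alpha>(2) that by simp
    moreover have "(\<Sum>c\<in>C. \<beta> c * w c t) = 0" unfolding split S_def using b by simp
    moreover have "\<exists>c\<in>C. \<beta> c \<noteq> 0" using \<alpha>(1) by (auto simp: \<beta>_def)
    ultimately show ?thesis by blast
  qed
qed

text \<open>A maximal independent subset of \<open>set (cols A)\<close> has \<open>rank A\<close>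
  elements. Choosing one index for each of its vectors gives \<open>C\<close>, so repeated columns
  do no harm.\<close>

lemma (in vec_space) ex_independent_column_indices:
  assumes A: "A \<in> carrier_mat n nc"
  shows "\<exists>C\<subseteq>{..<nc}. card C = rank A \<and>
    (\<forall>\<alpha>. (\<forall>i<n. (\<Sum>j\<in>C. \<alpha> j * A $$ (i, j)) = 0) \<longrightarrow> (\<forall>j\<in>C. \<alpha> j = 0))"
proof -
  obtain U where U: "maximal U (\<lambda>T. T \<subseteq> set (cols A) \<and> lin_indpt T)"
    using maximal_exists_superset[of "set (cols A)" "\<lambda>T. T \<subseteq> set (cols A) \<and> lin_indpt T" "{}"]
    by (auto simp: lin_dep_def)
  have Uc: "U \<subseteq> set (cols A)" and Ui: "lin_indpt U" using U by (auto simp: maximal_def)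
  have Ud: "U \<subseteq> carrier_vec n" using Uc cols_dim A by blast
  have fin: "finite U" using Uc finite_subset by blast
  have "U \<subseteq> col A ` {..<nc}" using Uc A by (auto simp: cols_def)
  then obtain C where C: "C \<subseteq> {..<nc}" "inj_on (col A) C" "U = col A ` C"
    by (meson subset_image_inj)
  have "\<forall>j\<in>C. \<alpha> j = 0" if \<alpha>: "\<forall>i<n. (\<Sum>j\<in>C. \<alpha> j * A $$ (i, j)) = 0" for \<alpha>
  proof (rule ccontr)
    assume "\<not> ?thesis"
    then obtain j where j: "j \<in> C" "\<alpha> j \<noteq> 0" by blast
    define a where "a = \<alpha> \<circ> the_inv_into C (col A)"
    have a: "a (col A j) = \<alpha> j" if "j \<in> C" for j
      using that C by (simp add: a_def the_inv_into_f_f)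
    have "lincomb a U = 0\<^sub>v n"
    proof (rule eq_vecI)
      fix i assume "i < dim_vec (0\<^sub>v n)"
      then have i: "i < n" by simp
      have "lincomb a U $ i = (\<Sum>u\<in>U. a u * u $ i)" using lincomb_index[OF i Ud] by simp
      also have "\<dots> = (\<Sum>j\<in>C. \<alpha> j * A $$ (i, j))" unfolding C(3)
        using C i A by (subst sum.reindex) (auto simp: a intro!: sum.cong)
      finally show "lincomb a U $ i = 0\<^sub>v n $ i" using \<alpha> i by simp
    qed (use Ud fin in simp)
    moreover have "a (col A j) \<noteq> 0" using a j by simp
    ultimately have "lin_dep U" unfolding lin_dep_def using fin j C(3)
      by (intro exI[of _ U] exI[of _ a] exI[of _ "col A j"]) auto
    then show False using Ui by blast
  qed
  moreover have "card C = rank A" using rank_card_indpt[OF A U] C card_image by metis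
  ultimately show ?thesis using C(1) by blast
qed

text \<open>A relation with \<open>w s \<noteq> 0\<close> leaves only \<open>card T - 1\<close>
  conditions for a combination of the columns in \<open>C\<close> to vanish. This is less than
  \<open>card C\<close>, so a nontrivial combination vanishes, contrary to the independence of these
  columns.\<close>

lemma full_rank_factorization_independent:
  fixes x y :: "'t \<Rightarrow> nat \<Rightarrow> real" and M :: "real mat"
  assumes T: "finite T" "card T \<le> vec_space.rank (dim_row M) M"
    and M: "\<And>i j. i < dim_row M \<Longrightarrow> j < dim_col M \<Longrightarrow> M $$ (i, j) = (\<Sum>t\<in>T. x t i * y t j)"
  shows "(\<forall>i<dim_row M. (\<Sum>t\<in>T. w t * x t i) = 0) \<Longrightarrow> \<forall>t\<in>T. w t = 0"
    and "(\<forall>j<dim_col M. (\<Sum>t\<in>T. w t * y t j) = 0) \<Longrightarrow> \<forall>t\<in>T. w t = 0"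
proof -
  obtain C where C: "C \<subseteq> {..<dim_col M}" "card C = vec_space.rank (dim_row M) M"
    and ind: "\<And>\<alpha>. (\<forall>i<dim_row M. (\<Sum>j\<in>C. \<alpha> j * M $$ (i, j)) = 0) \<Longrightarrow> \<forall>j\<in>C. \<alpha> j = 0"
    using vec_space.ex_independent_column_indices[of M "dim_row M" "dim_col M"] by auto
  have fC: "finite C" using C(1) finite_subset by blast
  have MC: "(\<Sum>j\<in>C. \<alpha> j * M $$ (i, j)) = (\<Sum>t\<in>T. (\<Sum>j\<in>C. \<alpha> j * y t j) * x t i)"
    if "i < dim_row M" for \<alpha> i
  proof -
    have "(\<Sum>j\<in>C. \<alpha> j * M $$ (i, j)) = (\<Sum>j\<in>C. \<Sum>t\<in>T. \<alpha> j * y t j * x t i)"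
      using C(1) that by (intro sum.cong) (auto simp: M sum_distrib_left ac_simps)
    then show ?thesis by (subst (asm) sum.swap) (simp add: sum_distrib_right)
  qed
  have smaller: "card (T - {t}) < card C" if "t \<in> T" for t
  proof -
    have "card (T - {t}) < card T" using T(1) that by (rule card_Diff1_less)
    then show ?thesis using T(2) C(2) by linarith
  qed
  show "\<forall>t\<in>T. w t = 0" if w: "\<forall>i<dim_row M. (\<Sum>t\<in>T. w t * x t i) = 0"
  proof (rule ccontr)
    assume "\<not> ?thesis"
    then obtain s where s: "s \<in> T" "w s \<noteq> 0" by blast
    \<comment> \<open>The conditions make the coefficients \<open>Y t\<close> proportional to
      \<open>w t\<close>, so that the relation among the \<open>x t\<close> annihilates the
      combination; the condition for \<open>t = s\<close> is trivial.\<close>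
    obtain \<alpha> where \<alpha>: "\<exists>j\<in>C. \<alpha> j \<noteq> 0"
      "\<forall>t\<in>T - {s}. (\<Sum>j\<in>C. \<alpha> j * (w s * y t j - w t * y s j)) = 0"
      using underdetermined_system_solution[OF _ fC smaller[OF s(1)],
          of "\<lambda>j t. w s * y t j - w t * y s j"] T(1) by auto
    define Y where "Y t = (\<Sum>j\<in>C. \<alpha> j * y t j)" for t
    have "(\<Sum>j\<in>C. \<alpha> j * (w s * y t j - w t * y s j)) = w s * Y t - w t * Y s" for t
      by (simp add: Y_def right_diff_distrib sum_subtractf sum_distrib_left ac_simps)
    then have "w s * Y t = w t * Y s" if "t \<in> T" for t
      using \<alpha>(2) that by (cases "t = s") auto
    then have "Y t = Y s / w s * w t" if "t \<in> T" for t
      using s(2) that by (simp add: field_simps)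
    then have "(\<Sum>t\<in>T. Y t * x t i) = Y s / w s * (\<Sum>t\<in>T. w t * x t i)" for i
      by (simp add: sum_distrib_left mult.assoc)
    then have "\<forall>j\<in>C. \<alpha> j = 0" using w MC by (intro ind) (simp add: Y_def)
    then show False using \<alpha>(1) by blast
  qed
  show "\<forall>t\<in>T. w t = 0" if w: "\<forall>j<dim_col M. (\<Sum>t\<in>T. w t * y t j) = 0"
  proof (rule ccontr)
    assume "\<not> ?thesis"
    then obtain s where s: "s \<in> T" "w s \<noteq> 0" by blast
    \<comment> \<open>The conditions say \<open>Y t = 0\<close> for \<open>t \<noteq> s\<close>; the
      relation among the \<open>y t\<close> then yields \<open>Y s = 0\<close> too.\<close>
    obtain \<alpha> where \<alpha>: "\<exists>j\<in>C. \<alpha> j \<noteq> 0" "\<forall>t\<in>T - {s}. (\<Sum>j\<in>C. \<alpha> j * y t j) = 0"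
      using underdetermined_system_solution[OF _ fC smaller[OF s(1)], of "\<lambda>j t. y t j"] T(1)
      by auto
    define Y where "Y t = (\<Sum>j\<in>C. \<alpha> j * y t j)" for t
    have "(\<Sum>t\<in>T. w t * Y t) = (\<Sum>j\<in>C. \<alpha> j * (\<Sum>t\<in>T. w t * y t j))"
      unfolding Y_def sum_distrib_left by (subst sum.swap) (simp add: ac_simps)
    also have "\<dots> = 0" using w C(1) by (intro sum.neutral) auto
    finally have "w s * Y s + (\<Sum>t\<in>T - {s}. w t * Y t) = 0"
      using sum.remove[OF T(1) s(1), of "\<lambda>t. w t * Y t"] by simp
    then have "Y s = 0" using \<alpha>(2) s(2) by (simp add: Y_def)
    then have "Y t = 0" if "t \<in> T" for t using \<alpha>(2) that by (cases "t = s") (auto simp: Y_def)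
    then have "\<forall>j\<in>C. \<alpha> j = 0" using MC by (intro ind) (simp add: Y_def)
    then show False using \<alpha>(1) by blast
  qed
qed

section \<open>Sums of periodic functions and circulant matrices\<close>

lemma periodic_add_mult:
  fixes f :: "nat \<Rightarrow> 'a"
  assumes "\<And>p. f (p + n) = f p"
  shows "f (p + l * n) = f p"
proof (induction l)
  case (Suc l)
  have "f (p + Suc l * n) = f ((p + l * n) + n)" by (simp add: ac_simps)
  then show ?case using Suc assms by simp
qed simp

lemma sum_lessThan_add:
  fixes f :: "nat \<Rightarrow> 'a::comm_monoid_add"
  shows "(\<Sum>j<a + b. f j) = (\<Sum>j<a. f j) + (\<Sum>j<b. f (a + j))"
  by (induction b) (simp_all add: ac_simps)

lemma sum_window_Suc:
  fixes f :: "nat \<Rightarrow> 'a::ab_group_add"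
  shows "(\<Sum>j<n. f (Suc c + j)) = (\<Sum>j<n. f (c + j)) + f (c + n) - f c"
  by (induction n) simp_all

lemma sum_periodic_shift:
  fixes f :: "nat \<Rightarrow> 'a::ab_group_add"
  assumes "\<And>p. f (p + n) = f p"
  shows "(\<Sum>j<n. f (c + j)) = (\<Sum>j<n. f j)"
  by (induction c) (simp_all add: sum_window_Suc assms del: add_Suc)

lemma sum_periodic_window:
  fixes f :: "nat \<Rightarrow> 'a::comm_ring_1"
  assumes "\<And>p. f (p + d) = f p"
  shows "(\<Sum>j<d * l. f (c + j)) = of_nat l * (\<Sum>j<d. f j)"
proof (induction l)
  case (Suc l)
  have "(\<Sum>j<d. f (c + (d * l + j))) = (\<Sum>j<d. f j)"
    using sum_periodic_shift[of f d "c + d * l", OF assms] by (simp add: ac_simps)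
  moreover have "(\<Sum>j<d * Suc l. f (c + j)) = (\<Sum>j<d * l. f (c + j)) + (\<Sum>j<d. f (c + (d * l + j)))"
    using sum_lessThan_add[of "\<lambda>j. f (c + j)" "d * l" d] by (simp add: ac_simps)
  ultimately show ?case using Suc by (simp add: algebra_simps)
qed simp

text \<open>For \<open>k \<le> n\<close> these are the entries of
  \<open>circulant_D n (n - k)\<close>, extended periodically to all natural \<open>p\<close> and
  \<open>q\<close> so that sums may run over shifted windows.\<close>

abbreviation circ :: "nat \<Rightarrow> nat \<Rightarrow> nat \<Rightarrow> nat \<Rightarrow> real" where
  "circ n k p q \<equiv> of_bool ((int q - int p) mod int n < int k)"

text \<open>The ones of row \<open>p\<close> fill the cyclic window of length \<open>k\<close>
  starting at \<open>p\<close>; periodicity of \<open>z\<close> removes the wrap-around.\<close>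

lemma sum_circ_row:
  fixes z :: "nat \<Rightarrow> real"
  assumes "k \<le> n" and z: "\<And>q. z (q + n) = z q"
  shows "(\<Sum>q<n. circ n k p q * z q) = (\<Sum>j<k. z (p + j))"
proof -
  have per: "circ n k p (q + n) * z (q + n) = circ n k p q * z q" for q
  proof -
    have "int (q + n) - int p = int q - int p + int n" by simp
    then show ?thesis using z by (simp only: mod_add_self2)
  qed
  have "(\<Sum>q<n. circ n k p q * z q) = (\<Sum>j<n. circ n k p (p + j) * z (p + j))"
    by (rule sum_periodic_shift[symmetric]) (rule per)
  also have "\<dots> = (\<Sum>j<n. of_bool (j < k) * z (p + j))" by (intro sum.cong) auto
  also have "\<dots> = (\<Sum>j<k + (n - k). of_bool (j < k) * z (p + j))" using assms(1) by simp
  also have "\<dots> = (\<Sum>j<k. z (p + j))" unfolding sum_lessThan_add by simp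
  finally show ?thesis .
qed

text \<open>The ones of column \<open>q\<close> fill the cyclic window of length \<open>k\<close>
  ending at \<open>q\<close>. Its start \<open>q + 1 - k\<close> is shifted by \<open>n\<close> to
  remain a natural number.\<close>

lemma sum_circ_column:
  fixes z :: "nat \<Rightarrow> real"
  assumes "k \<le> n" and z: "\<And>p. z (p + n) = z p"
  shows "(\<Sum>p<n. circ n k p q * z p) = (\<Sum>j<k. z (Suc q + (n - k) + j))"
proof -
  have per: "circ n k (p + n) q * z (p + n) = circ n k p q * z p" for p
  proof -
    have "int q - int (p + n) = int q - int p - int n" by simp
    then show ?thesis using z by (simp only: minus_mod_self2)
  qed
  have *: "(int q - int (Suc q + j)) mod int n = int n - 1 - int j" if "j < n" for j
  proof -
    have "(int q - int (Suc q + j)) mod int n = (int n - 1 - int j - int n) mod int n"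
      by (simp add: algebra_simps)
    also have "\<dots> = int n - 1 - int j" using that by (simp only: minus_mod_self2) simp
    finally show ?thesis .
  qed
  have "(\<Sum>p<n. circ n k p q * z p) = (\<Sum>j<n. circ n k (Suc q + j) q * z (Suc q + j))"
    by (rule sum_periodic_shift[symmetric]) (rule per)
  also have "\<dots> = (\<Sum>j<n. of_bool (n - k \<le> j) * z (Suc q + j))"
    by (rule sum.cong[OF refl], subst *) auto
  also have "\<dots> = (\<Sum>j<(n - k) + k. of_bool (n - k \<le> j) * z (Suc q + j))" using assms(1) by simp
  also have "\<dots> = (\<Sum>j<k. z (Suc q + (n - k) + j))"
    unfolding sum_lessThan_add by (simp add: ac_simps)
  finally show ?thesis .
qed

text \<open>Multiplication by \<open>k\<close>, a unit modulo \<open>n\<close>, permutes the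
  residues modulo \<open>n\<close>.\<close>

lemma sum_periodic_coprime_step:
  fixes h :: "nat \<Rightarrow> 'a::comm_monoid_add"
  assumes per: "\<And>l. h (l + n) = h l" and cop: "coprime n k"
  shows "(\<Sum>s<n. h (s * k)) = (\<Sum>s<n. h s)"
proof -
  have h: "h (p mod n) = h p" for p
    using periodic_add_mult[of h n "p mod n" "p div n", OF per] by simp
  have inj: "inj_on (\<lambda>s. s * k mod n) {..<n}"
  proof (rule inj_onI)
    fix s t assume st: "s \<in> {..<n}" "t \<in> {..<n}" "s * k mod n = t * k mod n"
    then have "int n dvd int s * int k - int t * int k"
      by (metis mod_eq_dvd_iff of_nat_mod of_nat_mult)
    then have "int n dvd (int s - int t) * int k" by (simp add: left_diff_distrib)
    then have "int n dvd int s - int t" using cop by (simp add: coprime_dvd_mult_left_iff)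
    then have "int s mod int n = int t mod int n" by (simp add: mod_eq_dvd_iff)
    then show "s = t" using st by simp
  qed
  moreover have "(\<lambda>s. s * k mod n) ` {..<n} \<subseteq> {..<n}" by auto
  ultimately have "(\<lambda>s. s * k mod n) ` {..<n} = {..<n}" by (intro endo_inj_surj) auto
  then have "(\<Sum>s<n. h s) = (\<Sum>s<n. h (s * k mod n))" using inj
    by (metis (mono_tags, lifting) sum.reindex_cong)
  then show ?thesis by (simp add: h)
qed

text \<open>Solves one circulant block with right-hand side \<open>x\<close> over the integers. The
  recursion for \<open>z\<close> controls only differences of consecutive windows, whence the
  constant \<tau>.\<close>

lemma ex_integral_window_solution:
  fixes x :: "nat \<Rightarrow> real"
  assumes d: "d > 0" and n: "n = d * n'" and k: "k = d * k'" and k': "k' > 0"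
    and cop: "coprime n' k'"
    and per: "\<And>p. x (p + n) = x p" and int: "\<And>p. x p \<in> \<int>"
    and bal: "\<And>c. (\<Sum>l<n'. x (c + l * d)) = a"
  shows "\<exists>z \<tau>. (\<forall>p. z (p + n) = z p) \<and> (\<forall>p. z p \<in> \<int>) \<and> \<tau> \<in> \<int> \<and>
    (\<forall>p. (\<Sum>j<k. z (p + j)) = x p + \<tau>)"
proof -
  \<comment> \<open>Since \<open>k * u = d + t * n\<close>, moving by \<open>d\<close> modulo
    \<open>n\<close> takes \<open>u\<close> steps of length \<open>k\<close>. Hence \<open>p\<close>
    is reached from \<open>p mod d\<close> in \<open>u * (p div d)\<close> steps, the number used in
    \<open>z\<close>.\<close>
  obtain u t where ut: "k' * u = n' * t + 1"
    using bezout_nat[of k' n'] k' cop by (metis coprime_commute coprime_imp_gcd_eq_1 neq0_conv)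
  \<comment> \<open>Comparing consecutive windows, \<open>z\<close> must satisfy \<open>z (p + k) - z p = \<delta> p\<close>. Steps of length \<open>k\<close>
    run cyclically through each residue class mod \<open>d\<close>, so this recursion determines \<open>z\<close> up to a
    constant per class; it is consistent since \<open>\<delta>\<close> sums to 0 over each class.\<close>
  define \<delta> where "\<delta> p = x (Suc p) - x p" for p
  define G where "G c j = (\<Sum>s<j. \<delta> (c + s * k))" for c j
  define z where "z p = G (p mod d) (u * (p div d))" for p
  have "(\<Sum>s<n'. x (c + s * k)) = a" for c
  proof -
    have "x (c + (l + n') * d) = x (c + l * d)" for l
      using per[of "c + l * d"] by (simp add: n algebra_simps)
    from sum_periodic_coprime_step[of "\<lambda>l. x (c + l * d)", OF this cop] show ?thesis
      by (simp add: bal k ac_simps)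
  qed
  then have full: "(\<Sum>s<n'. \<delta> (c + s * k)) = 0" for c
    unfolding \<delta>_def sum_subtractf using \<open>\<And>c. (\<Sum>s<n'. x (c + s * k)) = a\<close>[of "Suc c"] by simp
  have G1: "G c (j + n') = G c j" for c j
    using full[of "c + j * k"] by (simp add: G_def sum_lessThan_add algebra_simps)
  have G: "G c (j + l * n') = G c j" for c j l
    by (rule periodic_add_mult) (rule G1)
  have \<delta>: "\<delta> (p + l * n) = \<delta> p" for p l
    using periodic_add_mult[of x n p l, OF per] periodic_add_mult[of x n "Suc p" l, OF per]
    by (simp add: \<delta>_def)
  have "z (p + n) = z p" for p
    using G[of "p mod d" "u * (p div d)" u] d by (simp add: z_def n distrib_left ac_simps)
  moreover have "z p \<in> \<int>" for p unfolding z_def G_def \<delta>_def by (intro Ints_sum Ints_diff int)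
  moreover have step: "z (p + k) = z p + \<delta> p" for p
  proof -
    \<comment> \<open>As \<open>u * k' = n' * t + 1\<close>, advancing by \<open>k\<close> adds one
      step and \<open>t\<close> full cycles, which contribute nothing. The extra summand sits at a
      position congruent to \<open>p\<close> modulo \<open>n\<close>.\<close>
    have "z (p + k) = G (p mod d) (Suc (u * (p div d)) + t * n')"
      using d ut by (simp add: z_def k distrib_left ac_simps)
    also have "\<dots> = z p + \<delta> (p mod d + u * (p div d) * k)" by (simp only: G) (simp add: z_def G_def)
    also have "p mod d + u * (p div d) * k = p mod d + d * (p div d) * (k' * u)"
      by (simp add: k ac_simps)
    also have "\<dots> = p mod d + d * (p div d) + (t * (p div d)) * n"
      unfolding ut n by (simp add: algebra_simps)
    finally show ?thesis by (simp only: \<delta>) simp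
  qed
  \<comment> \<open>Both sides have increment \<open>\<delta> p\<close>, and they agree at
    \<open>p = 0\<close>.\<close>
  moreover have "(\<Sum>j<k. z (p + j)) = x p + ((\<Sum>j<k. z j) - x 0)" for p
    by (induction p) (simp_all add: sum_window_Suc step \<delta>_def del: add_Suc)
  moreover have "(\<Sum>j<k. z j) - x 0 \<in> \<int>" using calculation(2) int by (intro Ints_diff Ints_sum)
  ultimately show ?thesis by blast
qed

lemma sum_residue_classes:
  fixes h :: "nat \<Rightarrow> 'a::comm_monoid_add"
  shows "(\<Sum>p<d * n. h p) = (\<Sum>\<rho><d. \<Sum>l<n. h (\<rho> + l * d))"
proof -
  have "(\<Sum>p<d * n. h p) = (\<Sum>l<n. \<Sum>p = l * d..<l * d + d. h p)"
    by (simp add: sum.nat_group mult.commute)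
  also have "\<dots> = (\<Sum>l<n. \<Sum>\<rho><d. h (\<rho> + l * d))"
  proof (rule sum.cong[OF refl])
    fix l
    show "(\<Sum>p = l * d..<l * d + d. h p) = (\<Sum>\<rho><d. h (\<rho> + l * d))"
      using sum.shift_bounds_nat_ivl[of h 0 "l * d" d]
      by (simp add: atLeast0LessThan add.commute)
  qed
  also have "\<dots> = (\<Sum>\<rho><d. \<Sum>l<n. h (\<rho> + l * d))" by (rule sum.swap)
  finally show ?thesis .
qed

lemma sum_of_bool_residue_class:
  fixes h :: "nat \<Rightarrow> 'a::semiring_1"
  assumes "\<rho> < d"
  shows "(\<Sum>p<d * n. of_bool (p mod d = \<rho>) * h p) = (\<Sum>l<n. h (\<rho> + l * d))"
proof -
  have "(\<Sum>p<d * n. of_bool (p mod d = \<rho>) * h p)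
      = (\<Sum>\<sigma><d. \<Sum>l<n. of_bool ((\<sigma> + l * d) mod d = \<rho>) * h (\<sigma> + l * d))"
    by (rule sum_residue_classes)
  also have "\<dots> = (\<Sum>\<sigma><d. if \<sigma> = \<rho> then \<Sum>l<n. h (\<rho> + l * d) else 0)"
    by (intro sum.cong) auto
  finally show ?thesis using assms by simp
qed

section \<open>The block matrix, its kernels and balanced vectors\<close>

text \<open>Block sizes and window length are divided by \<open>d\<close>: the gcd condition becomes
  coprimality, and \<open>n_i > d\<close> becomes \<open>n' i > 1\<close>.\<close>

locale circulant_blocks =
  fixes m d k' :: nat and n' :: "nat \<Rightarrow> nat"
  assumes d: "d > 1" and k': "k' > 0"
    and k'_le: "\<And>i. i < m \<Longrightarrow> k' \<le> n' i"
    and coprime: "\<And>i. i < m \<Longrightarrow> coprime (n' i) k'"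
    and large_block: "\<exists>i<m. n' i > 1"
begin

text \<open>The index \<open>(i, p)\<close> stands for row or column \<open>p\<close> of the \<open>i\<close>-th block.\<close>

definition E :: "(nat \<times> nat) set" where
  "E = Sigma {..<m} (\<lambda>i. {..<d * n' i})"

definition entry :: "nat \<times> nat \<Rightarrow> nat \<times> nat \<Rightarrow> real" where
  "entry e f = 1 - (if fst e = fst f then circ (d * n' (fst e)) (d * k') (snd e) (snd f) else 0)"

definition N' :: nat where "N' = (\<Sum>i<m. n' i)"

definition balanced :: "(nat \<times> nat \<Rightarrow> real) \<Rightarrow> bool" where
  "balanced x \<longleftrightarrow>
     (\<forall>i<m. \<forall>\<rho><d. (\<Sum>l<n' i. x (i, \<rho> + l * d)) = (\<Sum>l<n' i. x (i, l * d)))"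

text \<open>For balanced \<open>x\<close> this is the common sum over the residue classes of block
  \<open>i\<close>, read off at residue 0.\<close>

definition weight :: "(nat \<times> nat \<Rightarrow> real) \<Rightarrow> nat \<Rightarrow> real" where
  "weight x i = (\<Sum>l<n' i. x (i, l * d))"

definition residue_diff :: "nat \<Rightarrow> nat \<Rightarrow> nat \<times> nat \<Rightarrow> real" where
  "residue_diff i \<rho> e =
     (if fst e = i then of_bool (snd e mod d = \<rho>) - of_bool (snd e mod d = 0) else 0)"

lemma finite_E: "finite E" by (simp add: E_def)

lemma sum_E: "(\<Sum>e\<in>E. f e) = (\<Sum>i<m. \<Sum>p<d * n' i. f (i, p))"
  unfolding E_def by (subst sum.Sigma) auto

lemma card_E: "real (card E) = real d * real N'"
  using sum_E[of "\<lambda>_. 1 :: real"] by (simp add: N'_def sum_distrib_left)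

text \<open>In a block with \<open>n' i > 1\<close>, coprimality excludes \<open>n' i = k'\<close>.
  The number \<open>N' - k'\<close> will serve as a positive divisor.\<close>

lemma k'_less_N': "k' < N'"
proof -
  obtain i where i: "i < m" "n' i > 1" using large_block by blast
  have "n' i \<noteq> k'" using coprime[OF i(1)] i(2) by auto
  then have "k' < n' i" using k'_le[OF i(1)] by simp
  also have "n' i \<le> N'" unfolding N'_def using i(1) by (intro member_le_sum) auto
  finally show ?thesis .
qed

lemma sum_entry_row:
  assumes "e \<in> E"
  shows "(\<Sum>f\<in>E. entry e f * v f) = (\<Sum>f\<in>E. v f) -
    (\<Sum>q<d * n' (fst e). circ (d * n' (fst e)) (d * k') (snd e) q * v (fst e, q))"
proof -
  have "(\<Sum>f\<in>E. entry e f * v f) = (\<Sum>f\<in>E. v f) - (\<Sum>j<m. if j = fst e then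
      (\<Sum>q<d * n' (fst e). circ (d * n' (fst e)) (d * k') (snd e) q * v (fst e, q)) else 0)"
    unfolding sum_E sum_subtractf[symmetric]
    by (intro sum.cong refl) (auto simp: entry_def left_diff_distrib sum_subtractf)
  then show ?thesis using assms by (auto simp: E_def)
qed

lemma sum_entry_column:
  assumes "f \<in> E"
  shows "(\<Sum>e\<in>E. entry e f * v e) = (\<Sum>e\<in>E. v e) -
    (\<Sum>p<d * n' (fst f). circ (d * n' (fst f)) (d * k') p (snd f) * v (fst f, p))"
proof -
  have "(\<Sum>e\<in>E. entry e f * v e) = (\<Sum>e\<in>E. v e) - (\<Sum>j<m. if j = fst f then
      (\<Sum>p<d * n' (fst f). circ (d * n' (fst f)) (d * k') p (snd f) * v (fst f, p)) else 0)"
    unfolding sum_E sum_subtractf[symmetric]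
    by (intro sum.cong refl) (auto simp: entry_def left_diff_distrib sum_subtractf)
  then show ?thesis using assms by (auto simp: E_def)
qed

lemma sum_entry_row_1:
  assumes "e \<in> E"
  shows "(\<Sum>f\<in>E. entry e f) = real d * (real N' - real k')"
proof -
  have "fst e < m" using assms by (auto simp: E_def)
  then have "(\<Sum>q<d * n' (fst e). circ (d * n' (fst e)) (d * k') (snd e) q) = real (d * k')"
    using sum_circ_row[of "d * k'" "d * n' (fst e)" "\<lambda>_. 1" "snd e"] k'_le by simp
  then show ?thesis
    using sum_entry_row[OF assms, of "\<lambda>_. 1"] by (simp add: card_E right_diff_distrib)
qed

lemma balanced_block_sum:
  assumes "balanced x" "i < m"
  shows "(\<Sum>p<d * n' i. x (i, p)) = real d * weight x i"
  using assms unfolding sum_residue_classes balanced_def weight_def by simp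

lemma balanced_sum:
  assumes "balanced x"
  shows "(\<Sum>e\<in>E. x e) = real d * (\<Sum>i<m. weight x i)"
  unfolding sum_E sum_distrib_left using balanced_block_sum[OF assms] by (intro sum.cong) auto

text \<open>Within its block the vector has period \<open>d\<close> and sums to 0 over each period,
  hence over windows of length \<open>d * k'\<close> and over the whole block.\<close>

lemma residue_diff_kernel:
  assumes i: "i < m" and \<rho>: "\<rho> < d"
  shows "e \<in> E \<Longrightarrow> (\<Sum>f\<in>E. entry e f * residue_diff i \<rho> f) = 0"
    and "f \<in> E \<Longrightarrow> (\<Sum>e\<in>E. entry e f * residue_diff i \<rho> e) = 0"
proof -
  define z :: "nat \<Rightarrow> real" where "z p = of_bool (p mod d = \<rho>) - of_bool (p mod d = 0)" for p
  have zd: "z (p + d) = z p" for p by (simp add: z_def)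
  have zn: "z (p + d * l) = z p" for p l by (simp add: z_def)
  have z0: "(\<Sum>p<d. z p) = 0"
    using sum_of_bool_residue_class[of \<rho> d "\<lambda>_. 1::real" 1]
      sum_of_bool_residue_class[of 0 d "\<lambda>_. 1::real" 1] \<rho> by (simp add: z_def sum_subtractf)
  have win: "(\<Sum>j<d * l. z (c + j)) = 0" for l c using sum_periodic_window[of z d c l] zd z0 by simp
  have zi: "residue_diff i \<rho> (j, p) = (if j = i then z p else 0)" for j p
    by (simp add: residue_diff_def z_def)
  have tot: "(\<Sum>e\<in>E. residue_diff i \<rho> e) = 0" unfolding sum_E
  proof (rule sum.neutral, rule ballI)
    fix j
    show "(\<Sum>p<d * n' j. residue_diff i \<rho> (j, p)) = 0"
      using win[of 0 "n' j"] by (cases "j = i") (simp_all add: zi)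
  qed
  show "(\<Sum>f\<in>E. entry e f * residue_diff i \<rho> f) = 0" if "e \<in> E"
    using sum_entry_row[OF that, of "residue_diff i \<rho>"] i k'_le tot
      sum_circ_row[of "d * k'" "d * n' i" z "snd e", OF _ zn] win
    by (cases "fst e = i") (auto simp: zi)
  show "(\<Sum>e\<in>E. entry e f * residue_diff i \<rho> e) = 0" if "f \<in> E"
    using sum_entry_column[OF that, of "residue_diff i \<rho>"] i k'_le tot
      sum_circ_column[of "d * k'" "d * n' i" z "snd f", OF _ zn] win
    by (cases "fst f = i") (auto simp: zi simp del: add_Suc)
qed

lemma balancedI:
  assumes "\<And>i \<rho>. i < m \<Longrightarrow> \<rho> < d \<Longrightarrow> (\<Sum>e\<in>E. residue_diff i \<rho> e * x e) = 0"
  shows "balanced x"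
  unfolding balanced_def
proof (intro allI impI)
  fix i \<rho> assume i: "i < m" and \<rho>: "\<rho> < d"
  have "(\<Sum>e\<in>E. residue_diff i \<rho> e * x e) = (\<Sum>j<m. if j = i then
      (\<Sum>p<d * n' i. of_bool (p mod d = \<rho>) * x (i, p)) - (\<Sum>p<d * n' i. of_bool (p mod d = 0) * x (i, p))
      else 0)"
    unfolding sum_E by (intro sum.cong) (auto simp: residue_diff_def left_diff_distrib sum_subtractf)
  then show "(\<Sum>l<n' i. x (i, \<rho> + l * d)) = (\<Sum>l<n' i. x (i, l * d))"
    using assms[OF i \<rho>] i \<rho> sum_of_bool_residue_class[of \<rho> d "\<lambda>p. x (i, p)" "n' i"]
      sum_of_bool_residue_class[of 0 d "\<lambda>p. x (i, p)" "n' i"] by simp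
qed

lemma weight_in_Ints:
  assumes "\<And>e. e \<in> E \<Longrightarrow> x e \<in> \<int>" "i < m"
  shows "weight x i \<in> \<int>"
  unfolding weight_def using assms d by (intro Ints_sum) (auto simp: E_def mult.commute)

section \<open>Explicit preimages of balanced vectors\<close>

lemma balanced_preimage_block:
  assumes bal: "balanced x" and int: "\<And>e. e \<in> E \<Longrightarrow> x e \<in> \<int>" and i: "i < m"
  shows "\<exists>z \<tau>. (\<forall>p. z (p + d * n' i) = z p) \<and> (\<forall>p. z p \<in> \<int>) \<and> \<tau> \<in> \<int> \<and>
    (\<forall>p<d * n' i. (\<Sum>j<d * k'. z (p + j)) = x (i, p) + \<tau>)"
proof -
  let ?n = "d * n' i"
  have n0: "?n > 0" using k'_le[OF i] k' d by simp
  define X where "X p = x (i, p mod ?n)" for p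
  have per: "X (p + ?n) = X p" for p by (simp add: X_def)
  have "X p \<in> \<int>" for p unfolding X_def using int i n0 by (simp add: E_def)
  moreover have "(\<Sum>l<n' i. X (c + l * d)) = weight x i" for c
  proof -
    \<comment> \<open>Balance is given for the classes \<open>c < d\<close>; a general
      \<open>c\<close> only shifts the index by \<open>c div d\<close>, which a full period does not
      notice.\<close>
    define h where "h l = X (c mod d + l * d)" for l
    have "h (l + n' i) = h l" for l
      using per[of "c mod d + l * d"] by (simp add: h_def algebra_simps)
    then have "(\<Sum>l<n' i. h (c div d + l)) = (\<Sum>l<n' i. h l)" by (rule sum_periodic_shift)
    moreover have "h (c div d + l) = X (c + l * d)" for l
      by (simp add: h_def distrib_right flip: add.assoc)
    moreover have "h l = x (i, c mod d + l * d)" if "l < n' i" for l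
    proof -
      have "c mod d + l * d < d + l * d" using d by simp
      also have "\<dots> = d * Suc l" by simp
      also have "\<dots> \<le> ?n" using that by (intro mult_le_mono2) simp
      finally show ?thesis by (simp add: h_def X_def)
    qed
    ultimately show ?thesis using bal i d by (simp add: balanced_def weight_def)
  qed
  ultimately obtain z \<tau> where "\<forall>p. z (p + ?n) = z p" "\<forall>p. z p \<in> \<int>" "\<tau> \<in> \<int>"
    "\<forall>p. (\<Sum>j<d * k'. z (p + j)) = X p + \<tau>"
    using ex_integral_window_solution[of d ?n "n' i" "d * k'" k' X, OF _ refl refl k' coprime[OF i] per]
      d by auto
  then show ?thesis by (intro exI[of _ z] exI[of _ \<tau>]) (simp add: X_def)
qed

text \<open>The preimage is \<open>g = s - \<zeta>\<close>, where \<zeta> solves the block diagonal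
  system and the constant \<open>s\<close> compensates for the all-ones part of the matrix. In the
  pairing with \<open>y\<close>, the only possibly non-integral contribution after multiplication by
  \<open>k'\<close> comes from \<open>s\<close>.\<close>

lemma balanced_preimage:
  assumes bal: "balanced x" and int: "\<And>e. e \<in> E \<Longrightarrow> x e \<in> \<int>"
  shows "\<exists>g. (\<forall>e\<in>E. (\<Sum>f\<in>E. entry e f * g f) = x e) \<and>
    (\<forall>y. balanced y \<longrightarrow> (\<forall>e\<in>E. y e \<in> \<int>) \<longrightarrow>
      (\<exists>c\<in>\<int>. real k' * (\<Sum>e\<in>E. y e * g e) =
        (\<Sum>i<m. weight x i) * (\<Sum>i<m. weight y i) / (real N' - real k') + c))"
proof -
  let ?k = "real d * real k'"
  have nz: "real d \<noteq> 0" "real k' \<noteq> 0" "real N' - real k' \<noteq> 0" using d k' k'_less_N' by auto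
  have "\<forall>i. \<exists>z \<tau>. i < m \<longrightarrow> (\<forall>p. z (p + d * n' i) = z p) \<and> (\<forall>p. z p \<in> \<int>) \<and> \<tau> \<in> \<int> \<and>
    (\<forall>p<d * n' i. (\<Sum>j<d * k'. z (p + j)) = x (i, p) + \<tau>)"
    using balanced_preimage_block[OF bal int] by blast
  then obtain z \<tau> where
    zper: "\<And>i p. i < m \<Longrightarrow> z i (p + d * n' i) = z i p" and
    zint: "\<And>i p. i < m \<Longrightarrow> z i p \<in> \<int>" and \<tau>int: "\<And>i. i < m \<Longrightarrow> \<tau> i \<in> \<int>" and
    zwin: "\<And>i p. i < m \<Longrightarrow> p < d * n' i \<Longrightarrow> (\<Sum>j<d * k'. z i (p + j)) = x (i, p) + \<tau> i"
    by metis
  \<comment> \<open>Each window has \<open>d * k'\<close> entries, so this shift removes \<tau> from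
    the window sums.\<close>
  define \<zeta> where "\<zeta> e = z (fst e) (snd e) - \<tau> (fst e) / ?k" for e
  have row: "(\<Sum>q<d * n' i. circ (d * n' i) (d * k') p q * \<zeta> (i, q)) = x (i, p)"
    if "i < m" "p < d * n' i" for i p
  proof -
    have "(\<Sum>q<d * n' i. circ (d * n' i) (d * k') p q * \<zeta> (i, q))
        = (\<Sum>j<d * k'. z i (p + j) - \<tau> i / ?k)"
      using sum_circ_row[of "d * k'" "d * n' i" "\<lambda>q. \<zeta> (i, q)" p] k'_le[OF that(1)] zper[OF that(1)]
      by (simp add: \<zeta>_def)
    also have "\<dots> = x (i, p)" unfolding sum_subtractf using zwin[OF that] nz by simp
    finally show ?thesis .
  qed
  have col: "(\<Sum>p<d * n' i. circ (d * n' i) (d * k') p q) = ?k" if "i < m" for i q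
    using sum_circ_column[of "d * k'" "d * n' i" "\<lambda>_. 1" q] k'_le[OF that] by simp
  \<comment> \<open>All column sums of the circulant blocks equal \<open>d * k'\<close>.\<close>
  have "(\<Sum>e\<in>E. x e) = ?k * (\<Sum>e\<in>E. \<zeta> e)"
  proof -
    have "(\<Sum>p<d * n' i. x (i, p)) = ?k * (\<Sum>q<d * n' i. \<zeta> (i, q))" if "i < m" for i
    proof -
      have "(\<Sum>p<d * n' i. x (i, p)) =
          (\<Sum>p<d * n' i. \<Sum>q<d * n' i. circ (d * n' i) (d * k') p q * \<zeta> (i, q))"
        using row[OF that] by simp
      also have "\<dots> = (\<Sum>q<d * n' i. (\<Sum>p<d * n' i. circ (d * n' i) (d * k') p q) * \<zeta> (i, q))"
        by (subst sum.swap) (simp only: sum_distrib_right)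
      finally show ?thesis unfolding col[OF that] by (simp only: sum_distrib_left)
    qed
    then show ?thesis unfolding sum_E sum_distrib_left by simp
  qed
  then have tot: "(\<Sum>e\<in>E. \<zeta> e) = (\<Sum>i<m. weight x i) / real k'"
    unfolding balanced_sum[OF bal] using nz by (simp add: field_simps)
  \<comment> \<open>Chosen so that \<open>s\<close> times the row sum \<open>d * (N' - k')\<close>
    of the matrix equals the total of \<zeta>.\<close>
  define s where "s = (\<Sum>i<m. weight x i) / (real k' * (real d * (real N' - real k')))"
  define g where "g e = s - \<zeta> e" for e
  have "(\<Sum>f\<in>E. entry e f * g f) = x e" if e: "e \<in> E" for e
  proof -
    have "(\<Sum>f\<in>E. entry e f * g f) = s * (\<Sum>f\<in>E. entry e f) - (\<Sum>f\<in>E. entry e f * \<zeta> f)"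
      by (simp add: g_def right_diff_distrib sum_subtractf sum_distrib_left mult.commute[of s])
    also have "(\<Sum>f\<in>E. entry e f * \<zeta> f) = (\<Sum>i<m. weight x i) / real k' - x e"
      using row[of "fst e" "snd e"] e unfolding sum_entry_row[OF e] tot by (auto simp: E_def)
    also have "s * (\<Sum>f\<in>E. entry e f) = (\<Sum>i<m. weight x i) / real k'"
      unfolding sum_entry_row_1[OF e] s_def using nz by (simp add: field_simps)
    finally show ?thesis by simp
  qed
  moreover have "\<exists>c\<in>\<int>. real k' * (\<Sum>e\<in>E. y e * g e) =
      (\<Sum>i<m. weight x i) * (\<Sum>i<m. weight y i) / (real N' - real k') + c"
    if y: "balanced y" "\<forall>e\<in>E. y e \<in> \<int>" for y
  proof -
    define c where "c = (\<Sum>i<m. \<tau> i * weight y i) - real k' * (\<Sum>e\<in>E. y e * z (fst e) (snd e))"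
    have "(\<Sum>i<m. \<tau> i * weight y i) \<in> \<int>"
      using y(2) \<tau>int by (intro Ints_sum Ints_mult weight_in_Ints) auto
    moreover have "(\<Sum>e\<in>E. y e * z (fst e) (snd e)) \<in> \<int>"
      using y(2) zint by (intro Ints_sum Ints_mult) (auto simp: E_def)
    ultimately have "c \<in> \<int>" unfolding c_def by (intro Ints_diff Ints_mult) auto
    \<comment> \<open>Balance of \<open>y\<close> supplies a factor \<open>d\<close>, which cancels
      the \<open>d\<close> in the denominator \<open>d * k'\<close> of the shift; multiplying by
      \<open>k'\<close> then suffices for integrality.\<close>
    have "(\<Sum>e\<in>E. y e * \<tau> (fst e)) = real d * (\<Sum>i<m. \<tau> i * weight y i)"
      unfolding sum_E sum_distrib_left
    proof (rule sum.cong[OF refl])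
      fix i assume "i \<in> {..<m}"
      then have "(\<Sum>p<d * n' i. y (i, p)) * \<tau> i = real d * (\<tau> i * weight y i)"
        using balanced_block_sum[OF y(1)] by simp
      then show "(\<Sum>p<d * n' i. y (i, p) * \<tau> (fst (i, p))) = real d * (\<tau> i * weight y i)"
        by (simp add: sum_distrib_right)
    qed
    moreover have "(\<Sum>e\<in>E. y e * g e) = s * (\<Sum>e\<in>E. y e)
        - (\<Sum>e\<in>E. y e * z (fst e) (snd e)) + (\<Sum>e\<in>E. y e * \<tau> (fst e)) / ?k"
      by (simp add: g_def \<zeta>_def algebra_simps sum_subtractf sum.distrib sum_distrib_left
          sum_divide_distrib)
    ultimately have "(\<Sum>e\<in>E. y e * g e) = s * (real d * (\<Sum>i<m. weight y i))
        - (\<Sum>e\<in>E. y e * z (fst e) (snd e)) + (\<Sum>i<m. \<tau> i * weight y i) / real k'"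
      unfolding balanced_sum[OF y(1)] using nz by simp
    moreover have "real k' * (s * (real d * (\<Sum>i<m. weight y i))) =
        (\<Sum>i<m. weight x i) * (\<Sum>i<m. weight y i) / (real N' - real k')"
      unfolding s_def using nz by simp
    ultimately have "real k' * (\<Sum>e\<in>E. y e * g e) =
        (\<Sum>i<m. weight x i) * (\<Sum>i<m. weight y i) / (real N' - real k') + c"
      unfolding c_def using nz by (simp add: right_diff_distrib distrib_left)
    with \<open>c \<in> \<int>\<close> show ?thesis by blast
  qed
  ultimately show ?thesis by blast
qed

text \<open>The indicator vectors of the aligned windows of length \<open>d\<close>, of which there are \<open>N'\<close>, and one
  further vector that is independent of them: all are balanced, hence in the range of the matrix,
  whose rank is therefore greater than \<open>N'\<close>.\<close>

definition test_vec :: "nat \<Rightarrow> (nat \<times> nat) option \<Rightarrow> nat \<times> nat \<Rightarrow> real" where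
  "test_vec i0 c e = (case c of
     Some (i, l) \<Rightarrow> of_bool (fst e = i \<and> snd e div d = l)
   | None \<Rightarrow> of_bool (e = (i0, 1)) - of_bool (e = (i0, 1 + d)))"

text \<open>The window vectors depend on a position only through its quotient by \<open>d\<close>.
  The extra vector has entries 1 and -1 in the same residue class, at positions that both lie in
  block \<open>i0\<close> because \<open>n' i0 > 1\<close>.\<close>

lemma balanced_test_vec:
  assumes "i0 < m" "n' i0 > 1"
  shows "balanced (test_vec i0 c)"
proof (cases c)
  case None
  have "(\<Sum>l<n' i. test_vec i0 None (i, \<rho> + l * d)) = 0" if "\<rho> < d" for i \<rho>
  proof (cases "i = i0 \<and> \<rho> = 1")
    case True
    have "\<rho> + l * d = 1 \<longleftrightarrow> l = 0" "\<rho> + l * d = 1 + d \<longleftrightarrow> l = 1" for l using True d by auto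
    then have "(\<Sum>l<n' i. test_vec i0 None (i, \<rho> + l * d)) = (\<Sum>l<n' i. of_bool (l = 0) - of_bool (l = 1))"
      using True by (simp add: test_vec_def)
    also have "\<dots> = (\<Sum>l<n' i. if l = 0 then 1 else 0) - (\<Sum>l<n' i. if l = 1 then 1 else 0)"
      unfolding sum_subtractf of_bool_def ..
    also have "\<dots> = 0" using assms True by simp
    finally show ?thesis .
  next
    case False
    have "(\<rho> + l * d) mod d = \<rho>" for l using that by simp
    moreover have "1 mod d = 1" "(1 + d) mod d = 1" using d by (simp_all only: mod_add_self2 mod_less)
    ultimately have "i = i0 \<longrightarrow> \<rho> + l * d \<noteq> 1 \<and> \<rho> + l * d \<noteq> 1 + d" for l using False by metis
    then have "test_vec i0 None (i, \<rho> + l * d) = 0" for l by (auto simp: test_vec_def)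
    then show ?thesis by simp
  qed
  from this this[of 0] show ?thesis using None d by (simp add: balanced_def)
next
  case (Some a)
  have "test_vec i0 c (i, \<rho> + l * d) = test_vec i0 c (i, l * d)" if "\<rho> < d" for i \<rho> l
    using that Some by (cases a) (simp add: test_vec_def)
  then show ?thesis by (simp add: balanced_def)
qed

section \<open>Contradiction from a factorization with independent 0-1 factors\<close>

context
  fixes T :: "'t set" and x y :: "'t \<Rightarrow> nat \<times> nat \<Rightarrow> real"
  assumes T: "finite T"
    and factor: "\<And>e f. e \<in> E \<Longrightarrow> f \<in> E \<Longrightarrow> entry e f = (\<Sum>t\<in>T. x t e * y t f)"
    and x01: "\<And>t e. x t e \<in> {0, 1}" and y01: "\<And>t e. y t e \<in> {0, 1}"
    and x_ind: "\<And>w. (\<forall>e\<in>E. (\<Sum>t\<in>T. w t * x t e) = 0) \<Longrightarrow> \<forall>t\<in>T. w t = 0"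
    and y_ind: "\<And>w. (\<forall>e\<in>E. (\<Sum>t\<in>T. w t * y t e) = 0) \<Longrightarrow> \<forall>t\<in>T. w t = 0"
begin

lemma factor_apply:
  assumes "e \<in> E"
  shows "(\<Sum>f\<in>E. entry e f * v f) = (\<Sum>t\<in>T. (\<Sum>f\<in>E. y t f * v f) * x t e)"
proof -
  have "(\<Sum>f\<in>E. entry e f * v f) = (\<Sum>f\<in>E. \<Sum>t\<in>T. y t f * v f * x t e)"
    using assms by (simp add: factor sum_distrib_left ac_simps)
  then show ?thesis by (subst (asm) sum.swap) (simp add: sum_distrib_right)
qed

lemma factor_apply_transpose:
  assumes "f \<in> E"
  shows "(\<Sum>e\<in>E. entry e f * v e) = (\<Sum>t\<in>T. (\<Sum>e\<in>E. x t e * v e) * y t f)"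
proof -
  have "(\<Sum>e\<in>E. entry e f * v e) = (\<Sum>e\<in>E. \<Sum>t\<in>T. x t e * v e * y t f)"
    using assms by (simp add: factor sum_distrib_left ac_simps)
  then show ?thesis by (subst (asm) sum.swap) (simp add: sum_distrib_right)
qed

text \<open>If the matrix kills \<open>r\<close>, then the \<open>x t\<close> with coefficients
  \<open>y t \<cdot> r\<close> sum to 0, so independence of the \<open>x t\<close> makes every
  \<open>y t\<close> orthogonal to \<open>r\<close>. Balance of the \<open>x t\<close> follows in
  the same way from the transpose and the independence of the \<open>y t\<close>.\<close>

lemma factors_balanced:
  assumes "t \<in> T"
  shows "balanced (x t)" and "balanced (y t)"
proof -
  show "balanced (x t)"
  proof (rule balancedI)
    fix i \<rho> assume "i < m" "\<rho> < d"
    then have "\<forall>t\<in>T. (\<Sum>e\<in>E. x t e * residue_diff i \<rho> e) = 0"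
      using residue_diff_kernel(2) by (intro y_ind) (simp flip: factor_apply_transpose)
    then show "(\<Sum>e\<in>E. residue_diff i \<rho> e * x t e) = 0" using assms by (simp add: mult.commute)
  qed
  show "balanced (y t)"
  proof (rule balancedI)
    fix i \<rho> assume "i < m" "\<rho> < d"
    then have "\<forall>t\<in>T. (\<Sum>e\<in>E. y t e * residue_diff i \<rho> e) = 0"
      using residue_diff_kernel(1) by (intro x_ind) (simp flip: factor_apply)
    then show "(\<Sum>e\<in>E. residue_diff i \<rho> e * y t e) = 0" using assms by (simp add: mult.commute)
  qed
qed

lemma factors_integral: "x t e \<in> \<int>" "y t e \<in> \<int>"
  using x01[of t e] y01[of t e] by auto

text \<open>An independent family has no zero member, and the entries are nonnegative.\<close>

lemma factors_nonzero:
  assumes t: "t \<in> T"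
  shows "(\<Sum>i<m. weight (x t) i) > 0" and "(\<Sum>i<m. weight (y t) i) > 0"
proof -
  have *: "(\<Sum>i<m. weight (w t) i) > 0"
    if ind: "\<And>c. (\<forall>e\<in>E. (\<Sum>t\<in>T. c t * w t e) = 0) \<Longrightarrow> \<forall>t\<in>T. c t = 0"
      and bal: "balanced (w t)" and w: "\<And>t e. w t e \<in> {0, 1}" for w :: "'t \<Rightarrow> nat \<times> nat \<Rightarrow> real"
  proof -
    have w0: "w t e \<ge> 0" for e using w[of t e] by auto
    have "\<exists>e\<in>E. w t e \<noteq> 0"
    proof (rule ccontr)
      assume "\<not> ?thesis"
      then have "\<forall>e\<in>E. (\<Sum>s\<in>T. of_bool (s = t) * w s e) = 0" by (auto intro!: sum.neutral)
      then show False using ind[of "\<lambda>s. of_bool (s = t)"] t by auto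
    qed
    then have "(\<Sum>e\<in>E. w t e) > 0" using w0 finite_E
      by (metis order_le_less sum_nonneg sum_nonneg_0)
    then show ?thesis using balanced_sum[OF bal] by (simp add: zero_less_mult_iff)
  qed
  show "(\<Sum>i<m. weight (x t) i) > 0" using x_ind factors_balanced(1)[OF t] x01 by (rule *)
  show "(\<Sum>i<m. weight (y t) i) > 0" using y_ind factors_balanced(2)[OF t] y01 by (rule *)
qed

lemma weight_product_ge:
  assumes t: "t \<in> T"
  shows "(\<Sum>i<m. weight (x t) i) * (\<Sum>i<m. weight (y t) i) \<ge> real N' - real k'"
proof -
  let ?ab = "(\<Sum>i<m. weight (x t) i) * (\<Sum>i<m. weight (y t) i)"
  obtain g where g: "\<forall>e\<in>E. (\<Sum>f\<in>E. entry e f * g f) = x t e"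
    and pair: "\<And>w. balanced w \<Longrightarrow> \<forall>e\<in>E. w e \<in> \<int> \<Longrightarrow> \<exists>c\<in>\<int>. real k' * (\<Sum>e\<in>E. w e * g e) =
        (\<Sum>i<m. weight (x t) i) * (\<Sum>i<m. weight w i) / (real N' - real k') + c"
    using balanced_preimage[OF factors_balanced(1)[OF t] factors_integral(1)] by blast
  \<comment> \<open>Applying the factorization to \<open>g\<close> expresses \<open>x t\<close> in
    the independent family \<open>x\<close>, so the coefficients are those of the trivial
    expression.\<close>
  have "\<forall>s\<in>T. (\<Sum>f\<in>E. y s f * g f) - of_bool (s = t) = 0"
  proof (rule x_ind, intro ballI)
    fix e assume e: "e \<in> E"
    have "(\<Sum>s\<in>T. of_bool (s = t) * x s e) = (\<Sum>s\<in>T. if s = t then x t e else 0)"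
      by (intro sum.cong) auto
    then show "(\<Sum>s\<in>T. ((\<Sum>f\<in>E. y s f * g f) - of_bool (s = t)) * x s e) = 0"
      using factor_apply[OF e, of g] g e t T by (simp add: left_diff_distrib sum_subtractf)
  qed
  then have "(\<Sum>f\<in>E. y t f * g f) = 1" using t by auto
  then obtain c where "c \<in> \<int>" "real k' = ?ab / (real N' - real k') + c"
    using pair[OF factors_balanced(2)[OF t]] factors_integral(2) by auto
  then have "?ab / (real N' - real k') = real k' - c" by simp
  then have "?ab / (real N' - real k') \<in> \<int>" using \<open>c \<in> \<int>\<close> by simp
  moreover have "?ab / (real N' - real k') > 0" using factors_nonzero[OF t] k'_less_N' by simp
  \<comment> \<open>A positive integer is at least 1.\<close>
  ultimately have "?ab / (real N' - real k') \<ge> 1" by (auto elim!: Ints_cases)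
  then show ?thesis using k'_less_N' by (simp add: field_simps)
qed

text \<open>Double counting of the ones: the \<open>d * N'\<close> rows contain
  \<open>d * (N' - k')\<close> each, while every rectangle has area at least
  \<open>d * d * (N' - k')\<close>.\<close>

lemma card_factors_le: "card T \<le> N'"
proof -
  have pos: "real N' - real k' > 0" using k'_less_N' by simp
  have "(\<Sum>e\<in>E. \<Sum>f\<in>E. entry e f) = (\<Sum>e\<in>E. real d * (real N' - real k'))"
    using sum_entry_row_1 by (rule sum.cong[OF refl])
  then have 1: "(\<Sum>e\<in>E. \<Sum>f\<in>E. entry e f) = (real d * real d) * (real N' * (real N' - real k'))"
    by (simp add: card_E)
  have "(\<Sum>e\<in>E. \<Sum>f\<in>E. entry e f) = (\<Sum>e\<in>E. \<Sum>t\<in>T. x t e * (\<Sum>f\<in>E. y t f))"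
    using factor_apply[of _ "\<lambda>_. 1"] by (simp add: mult.commute)
  also have "\<dots> = (\<Sum>t\<in>T. (\<Sum>e\<in>E. x t e) * (\<Sum>f\<in>E. y t f))"
    by (subst sum.swap) (simp only: sum_distrib_right)
  also have "\<dots> = (\<Sum>t\<in>T. (real d * real d) * ((\<Sum>i<m. weight (x t) i) * (\<Sum>i<m. weight (y t) i)))"
    by (intro sum.cong refl) (simp add: balanced_sum factors_balanced)
  also have "\<dots> \<ge> (\<Sum>t\<in>T. (real d * real d) * (real N' - real k'))"
    by (intro sum_mono mult_left_mono weight_product_ge) auto
  finally have "(real d * real d) * (real (card T) * (real N' - real k'))
      \<le> (real d * real d) * (real N' * (real N' - real k'))"
    unfolding 1 by (simp add: ac_simps)
  then have "real (card T) * (real N' - real k') \<le> real N' * (real N' - real k')"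
    using d by (subst (asm) mult_le_cancel_left_pos) auto
  then show ?thesis using pos by simp
qed

text \<open>With at most \<open>N'\<close> factors, some nontrivial combination of the preimages of
  the \<open>N' + 1\<close> test vectors is orthogonal to all \<open>y t\<close>. The matrix kills
  it, so the same combination of the test vectors vanishes, but these are independent.\<close>

lemma card_factors_gt: "card T > N'"
proof (rule ccontr)
  assume "\<not> card T > N'"
  obtain i0 where i0: "i0 < m" "n' i0 > 1" using large_block by blast
  define C where "C = insert None (Some ` Sigma {..<m} (\<lambda>i. {..<n' i}))"
  have fin: "finite C" by (simp add: C_def)
  have "card C = Suc N'" by (simp add: C_def N'_def card_image)
  then have card: "card T < card C" using \<open>\<not> card T > N'\<close> by simp
  have "test_vec i0 c e \<in> \<int>" for c e
    by (auto simp: test_vec_def split: option.split)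
  then have "\<forall>c. \<exists>g. \<forall>e\<in>E. (\<Sum>f\<in>E. entry e f * g f) = test_vec i0 c e"
    using balanced_preimage[OF balanced_test_vec[OF i0]] by blast
  then obtain g where g: "\<And>c e. e \<in> E \<Longrightarrow> (\<Sum>f\<in>E. entry e f * g c f) = test_vec i0 c e" by metis
  obtain \<alpha> where \<alpha>: "\<exists>c\<in>C. \<alpha> c \<noteq> 0" "\<forall>t\<in>T. (\<Sum>c\<in>C. \<alpha> c * (\<Sum>f\<in>E. y t f * g c f)) = 0"
    using underdetermined_system_solution[OF T fin card, of "\<lambda>c t. \<Sum>f\<in>E. y t f * g c f"] by blast
  have van: "(\<Sum>c\<in>C. \<alpha> c * test_vec i0 c e) = 0" if e: "e \<in> E" for e
  proof -
    have "(\<Sum>c\<in>C. \<alpha> c * test_vec i0 c e)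
        = (\<Sum>c\<in>C. \<Sum>t\<in>T. \<alpha> c * (\<Sum>f\<in>E. y t f * g c f) * x t e)"
      using g[OF e, symmetric] unfolding factor_apply[OF e]
      by (simp add: sum_distrib_left[of "\<alpha> _" _ T] mult.assoc)
    also have "\<dots> = (\<Sum>t\<in>T. (\<Sum>c\<in>C. \<alpha> c * (\<Sum>f\<in>E. y t f * g c f)) * x t e)"
      by (subst sum.swap) (simp only: sum_distrib_right)
    also have "\<dots> = 0" using \<alpha>(2) by simp
    finally show ?thesis .
  qed
  \<comment> \<open>Every position lies in exactly one aligned window.\<close>
  have sumC: "(\<Sum>c\<in>C. \<alpha> c * test_vec i0 c (i, p)) =
      \<alpha> None * test_vec i0 None (i, p) + \<alpha> (Some (i, p div d))" if "i < m" "p < d * n' i" for i p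
  proof -
    have mem: "(i, p div d) \<in> Sigma {..<m} (\<lambda>i. {..<n' i})"
      using that by (simp add: less_mult_imp_div_less mult.commute)
    have "(\<Sum>c\<in>C. \<alpha> c * test_vec i0 c (i, p)) = \<alpha> None * test_vec i0 None (i, p) +
      (\<Sum>b\<in>Sigma {..<m} (\<lambda>i. {..<n' i}). \<alpha> (Some b) * test_vec i0 (Some b) (i, p))"
      unfolding C_def by (subst sum.insert) (auto simp: sum.reindex)
    also have "(\<Sum>b\<in>Sigma {..<m} (\<lambda>i. {..<n' i}). \<alpha> (Some b) * test_vec i0 (Some b) (i, p))
      = (\<Sum>b\<in>Sigma {..<m} (\<lambda>i. {..<n' i}). if b = (i, p div d) then \<alpha> (Some b) else 0)"
      by (intro sum.cong) (auto simp: test_vec_def)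
    also have "\<dots> = \<alpha> (Some (i, p div d))" using mem by (subst sum.delta) auto
    finally show ?thesis .
  qed
  have Some0: "\<alpha> (Some (i, l)) = 0" if "i < m" "l < n' i" for i l
  proof -
    have p: "l * d < d * n' i" using that d by (simp add: mult.commute)
    \<comment> \<open>Since \<open>d > 1\<close>, the window starts \<open>l * d\<close> avoid
      residue 1, where the extra vector lives.\<close>
    have "l * d \<noteq> 1" "l * d \<noteq> 1 + d"
      using d by (metis less_irrefl nat_mult_eq_1_iff,
          metis dvd_add_left_iff dvd_refl dvd_triv_right less_irrefl nat_dvd_1_iff_1)
    then have "test_vec i0 None (i, l * d) = 0" by (simp add: test_vec_def)
    then show ?thesis using van[of "(i, l * d)"] sumC[OF that(1) p] that p d by (simp add: E_def)
  qed
  \<comment> \<open>Position 1 belongs to window 0, whose coefficient is already known to vanish;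
    only that of the extra vector remains.\<close>
  have p: "1 < d * n' i0" using i0 d by (metis less_1_mult)
  have "test_vec i0 None (i0, 1) = 1" using d by (simp add: test_vec_def)
  then have "\<alpha> None = 0"
    using van[of "(i0, 1)"] sumC[OF i0(1) p] Some0[of i0 0] i0 p d by (simp add: E_def)
  then show False using \<alpha>(1) Some0 by (auto simp: C_def)
qed

lemma no_full_rank_factorization: False
  using card_factors_le card_factors_gt by simp

end

end

section \<open>From block coordinates to matrix indices\<close>

lemma sum_list_take_add_less:
  fixes ns :: "nat list"
  assumes "i < length ns" "p < ns ! i"
  shows "sum_list (take i ns) + p < sum_list ns"
  using assms
proof (induction ns arbitrary: i)
  case (Cons n ns)
  then show ?case by (cases i) (auto simp: add.assoc)
qed simp

lemma sum_list_position:
  fixes ns :: "nat list"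
  assumes "r < sum_list ns"
  shows "\<exists>i<length ns. \<exists>p<ns ! i. r = sum_list (take i ns) + p"
  using assms
proof (induction ns arbitrary: r)
  case (Cons n ns)
  show ?case
  proof (cases "r < n")
    case True
    then show ?thesis by (intro exI[of _ 0]) auto
  next
    case False
    then obtain i p where "i < length ns" "p < ns ! i" "r - n = sum_list (take i ns) + p"
      using Cons.IH[of "r - n"] Cons.prems by (auto simp: less_diff_conv2 add.commute)
    then show ?thesis using False by (intro exI[of _ "Suc i"]) auto
  qed
qed simp

lemma index_diag_block_mat:
  assumes "i < length As" "j < length As" "p < dim_row (As ! i)" "q < dim_col (As ! j)"
  shows "diag_block_mat As $$
      (sum_list (take i (map dim_row As)) + p, sum_list (take j (map dim_col As)) + q)
    = (if i = j then As ! i $$ (p, q) else 0)"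
  using assms
proof (induction As arbitrary: i j)
  case (Cons A As)
  have bound: "sum_list (take i (map dim_row As)) + p < sum_list (map dim_row As)"
    if "i < length As" "p < dim_row (As ! i)" for i
    using sum_list_take_add_less[of i "map dim_row As" p] that by simp
  have bound': "sum_list (take i (map dim_col As)) + q < sum_list (map dim_col As)"
    if "i < length As" "q < dim_col (As ! i)" for i
    using sum_list_take_add_less[of i "map dim_col As" q] that by simp
  show ?case
    using Cons.prems Cons.IH bound bound'
    by (cases i; cases j) (auto simp: Let_def dim_diag_block_mat add.assoc)
qed simp

theorem theorem4p9:
  fixes k :: nat and ns :: "nat list" and M :: "real mat"
  assumes "length ns \<ge> 1"
    and "k > 0"
    and "\<forall>i<length ns. ns ! i \<ge> k"
    and "M = complement_mat (circulant_block_diag k ns)"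
    and "\<exists>d>1. (\<forall>i<length ns. d = gcd (ns ! i) k) \<and> (\<exists>i<length ns. ns ! i > d)"
  shows "binary_rank M \<ge> vec_space.rank (dim_row M) M + 1"
proof (rule ccontr)
  assume "\<not> ?thesis"
  then have small: "binary_rank M \<le> vec_space.rank (dim_row M) M" by simp
  obtain d where d: "d > 1" and gcd: "\<And>i. i < length ns \<Longrightarrow> gcd (ns ! i) k = d"
    and large: "\<exists>i<length ns. ns ! i > d" using assms(5) by metis
  define k' where "k' = k div d"
  define n' where "n' i = ns ! i div d" for i
  have "d dvd k" using gcd large by (metis gcd_dvd2)
  then have k: "k = d * k'" by (simp add: k'_def)
  have n: "ns ! i = d * n' i" if "i < length ns" for i
    using gcd[OF that] gcd_dvd1[of "ns ! i" k] by (simp add: n'_def)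
  interpret circulant_blocks "length ns" d k' n'
  proof
    show "d > 1" by fact
    show "k' > 0" using assms(2) k by (cases k') auto
    show "k' \<le> n' i" if "i < length ns" for i
      using assms(3)[rule_format, OF that] d unfolding n[OF that] k by simp
    show "coprime (n' i) k'" if "i < length ns" for i
      using div_gcd_coprime[of "ns ! i" k] gcd[OF that] assms(2) by (simp add: n'_def k'_def)
    show "\<exists>i<length ns. n' i > 1" using large n by (metis mult.right_neutral nat_mult_less_cancel_disj)
  qed
  \<comment> \<open>The blocks are square, so one map converts block coordinates for rows and for
    columns.\<close>
  define \<phi> where "\<phi> e = sum_list (take (fst e) ns) + snd e" for e
  define As where "As = map (\<lambda>n. circulant_D n (n - k)) ns"
  have dims: "map dim_row As = ns" "map dim_col As = ns"
    by (auto simp: As_def circulant_D_def intro!: map_idI)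
  have M: "M = complement_mat (diag_block_mat As)"
    using assms(4) by (simp add: circulant_block_diag_def As_def)
  have dimM: "dim_row M = sum_list ns" "dim_col M = sum_list ns"
    by (simp_all add: M complement_mat_def dim_diag_block_mat dims)
  have \<phi>_less: "\<phi> e < sum_list ns" if "e \<in> E" for e
    using that n sum_list_take_add_less[of "fst e" ns "snd e"] by (auto simp: E_def \<phi>_def)
  have \<phi>_surj: "\<exists>e\<in>E. r = \<phi> e" if "r < sum_list ns" for r
    using sum_list_position[OF that] n by (force simp: E_def \<phi>_def)
  have entry: "M $$ (\<phi> e, \<phi> f) = entry e f" if e: "e \<in> E" and f: "f \<in> E" for e f
  proof -
    have i: "fst e < length ns" "snd e < ns ! fst e" "fst f < length ns" "snd f < ns ! fst f"
      using e f n by (auto simp: E_def)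
    then have "diag_block_mat As $$ (\<phi> e, \<phi> f)
        = (if fst e = fst f then As ! fst e $$ (snd e, snd f) else 0)"
      using index_diag_block_mat[of "fst e" As "fst f" "snd e" "snd f"]
      unfolding dims \<phi>_def by (auto simp: As_def circulant_D_def)
    also have "\<dots> = (if fst e = fst f then circ (d * n' (fst e)) (d * k') (snd e) (snd f) else 0)"
    proof (cases "fst e = fst f")
      case True
      \<comment> \<open>\<open>circulant_D\<close> takes the number of zeros; the truncated
        subtraction is exact because \<open>k \<le> ns ! fst e\<close>.\<close>
      have "int (ns ! fst e) - int (ns ! fst e - k) = int (d * k')"
        using assms(3) i k by (simp add: of_nat_diff)
      then show ?thesis using i True n[of "fst e"] by (simp add: As_def circulant_D_def)
    qed simp
    finally show ?thesis
      using \<phi>_less[OF e] \<phi>_less[OF f]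
      by (simp add: M complement_mat_def dim_diag_block_mat dims entry_def)
  qed
  obtain P where P: "rectangle_partition M P" "card P = binary_rank M"
    using binary_rank_attained by blast
  then have fin: "finite P" and part: "partition_on (ones_of M) P"
    and rect: "\<And>R. R \<in> P \<Longrightarrow> \<exists>I J. R = I \<times> J" by (auto simp: rectangle_partition_def)
  \<comment> \<open>The sides of a rectangle are recovered as its projections, so no
    \<open>I\<close> and \<open>J\<close> need to be chosen.\<close>
  define x y :: "(nat \<times> nat) set \<Rightarrow> nat \<Rightarrow> real"
    where "x R p = of_bool (p \<in> fst ` R)" and "y R q = of_bool (q \<in> snd ` R)" for R p q
  have fac: "M $$ (p, q) = (\<Sum>R\<in>P. x R p * y R q)" if pq: "p < dim_row M" "q < dim_col M" for p q
  proof -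
    have xy: "x R p * y R q = of_bool ((p, q) \<in> R)" if "R \<in> P" for R
      using rect[OF that] by (force simp: x_def y_def)
    obtain e f where ef: "e \<in> E" "f \<in> E" "p = \<phi> e" "q = \<phi> f"
      using \<phi>_surj pq unfolding dimM by metis
    have 01: "M $$ (p, q) \<in> {0, 1}" using entry[OF ef(1,2)] ef by (auto simp: entry_def)
    show ?thesis
    proof (cases "(p, q) \<in> ones_of M")
      case True
      then obtain R where R: "R \<in> P" "(p, q) \<in> R" using partition_onD1[OF part] by blast
      have "x S p * y S q = (if S = R then 1 else 0)" if S: "S \<in> P" for S
        using xy[OF S] R S partition_onD2[OF part] by (auto simp: disjoint_def)
      then have "(\<Sum>S\<in>P. x S p * y S q) = 1" using fin R by simp
      then show ?thesis using True by (simp add: ones_of_def)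
    next
      case False
      then have "x S p * y S q = 0" if "S \<in> P" for S
        using xy[OF that] partition_onD1[OF part] that by auto
      moreover have "M $$ (p, q) = 0" using False 01 pq by (auto simp: ones_of_def)
      ultimately show ?thesis by simp
    qed
  qed
  have card: "card P \<le> vec_space.rank (dim_row M) M" using small P(2) by simp
  show False
  proof (rule no_full_rank_factorization[of P "\<lambda>R. x R \<circ> \<phi>" "\<lambda>R. y R \<circ> \<phi>"])
    show "entry e f = (\<Sum>R\<in>P. (x R \<circ> \<phi>) e * (y R \<circ> \<phi>) f)" if "e \<in> E" "f \<in> E" for e f
      using entry[OF that] fac[of "\<phi> e" "\<phi> f"] \<phi>_less that by (simp add: dimM)
    \<comment> \<open>Independence passes to block coordinates because \<phi> reaches every matrix
      index.\<close>
    show "\<forall>R\<in>P. w R = 0" if "\<forall>e\<in>E. (\<Sum>R\<in>P. w R * (x R \<circ> \<phi>) e) = 0" for w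
      using full_rank_factorization_independent(1)[OF fin card fac, of w] that \<phi>_surj
      by (metis (no_types, lifting) comp_apply dimM(1) sum.cong)
    show "\<forall>R\<in>P. w R = 0" if "\<forall>e\<in>E. (\<Sum>R\<in>P. w R * (y R \<circ> \<phi>) e) = 0" for w
      using full_rank_factorization_independent(2)[OF fin card fac, of w] that \<phi>_surj
      by (metis (no_types, lifting) comp_apply dimM(2) sum.cong)
  qed (use fin in \<open>auto simp: x_def y_def\<close>)
qed

end
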